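(* Let $F$ be a field of characteristic not $2$, let $B$ be a central simple division algebra over $F$, let $\sigma\in\mathrm{Aut}_F(B)$ be a non-trivial automorphism and let $c\in B^{\times}$. Let $D=D(B,\sigma,c)$ (respectively $D=D_r(B,\sigma,c)$). Then every $F$-algebra automorphism $G:D\to D$ is of the form $$G(u,v)=(\tau(u),\tau(v)b)\qquad(u,v\in B)$$ for some $\tau\in\mathrm{Aut}_F(B)$ with $\tau\circ\sigma=\sigma\circ\tau$ and some $b\in F^{\times}$ satisfying $\tau(c)=cb^2$. Conversely, every map of this form, with $\tau\in\mathrm{Aut}_F(B)$ and $b\in F^{\times}$ satisfying these conditions, is an $F$-algebra automorphism of $D$.
   Context: $D(B,\sigma,c)$ and $D_r(B,\sigma,c)$ denote the $F$-vector space $B\oplus B$ endowed, respectively, with the multiplications $(u,v)(x,y)=(ux+c\,\sigma(vy),\,uy+vx)$ and $(u,v)(x,y)=(ux+\sigma(vy)c,\,uy+vx)$, for $u,v,x,y\in B$. These are unital nonassociative $F$-algebras. *)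

theory Defs
  imports "HOL-Analysis.Product_Vector"
begin

text \<open>
  Algebras are given by their scalar multiplication (and, in the nonassociative case, their
  multiplication); addition is always that of the carrier type.
\<close>

locale central_simple_algebra = vector_space smul
  for smul :: "'f::field \<Rightarrow> 'b::ring_1 \<Rightarrow> 'b" +
  assumes smul_mult_left: "smul a x * y = smul a (x * y)"
    and smul_mult_right: "x * smul a y = smul a (x * y)"
    and finite_dim: "\<exists>S. finite S \<and> module.span smul S = UNIV"
    and central: "{z. \<forall>x. z * x = x * z} = range (\<lambda>a. smul a 1)"
    \<comment> \<open>two-sided ideals; closure under negation follows from multiplication by \<open>-1\<close>\<close>
    and simple: "\<lbrakk>0 \<in> (I :: 'b set); \<And>x y. \<lbrakk>x \<in> I; y \<in> I\<rbrakk> \<Longrightarrow> x + y \<in> I;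
       \<And>r x. x \<in> I \<Longrightarrow> r * x \<in> I; \<And>r x. x \<in> I \<Longrightarrow> x * r \<in> I\<rbrakk>
      \<Longrightarrow> I = {0} \<or> I = UNIV"

text \<open>The multiplication is an arbitrary binary operation, so that this covers both \<open>B\<close>
  and the nonassociative algebras on \<open>B \<oplus> B\<close>. A multiplicative bijection preserves the unit.\<close>

definition alg_automorphism ::
    "('f::field \<Rightarrow> 'a::ab_group_add \<Rightarrow> 'a) \<Rightarrow> ('a \<Rightarrow> 'a \<Rightarrow> 'a) \<Rightarrow> ('a \<Rightarrow> 'a) \<Rightarrow> bool"
  where "alg_automorphism smul mult f \<longleftrightarrow>
    Vector_Spaces.linear smul smul f \<and> bij f \<and> (\<forall>x y. f (mult x y) = mult (f x) (f y))"

definition D_mult :: "('b::ring_1 \<Rightarrow> 'b) \<Rightarrow> 'b \<Rightarrow> 'b \<times> 'b \<Rightarrow> 'b \<times> 'b \<Rightarrow> 'b \<times> 'b"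
  where "D_mult \<sigma> c = (\<lambda>(u, v) (x, y). (u * x + c * \<sigma> (v * y), u * y + v * x))"

definition Dr_mult :: "('b::ring_1 \<Rightarrow> 'b) \<Rightarrow> 'b \<Rightarrow> 'b \<times> 'b \<Rightarrow> 'b \<times> 'b \<Rightarrow> 'b \<times> 'b"
  where "Dr_mult \<sigma> c = (\<lambda>(u, v) (x, y). (u * x + \<sigma> (v * y) * c, u * y + v * x))"

end

theory Submission
  imports Defs
begin

text \<open>
  Both algebras have the multiplication \<open>(u, v) (x, y) = (u x + N (v y), u y + v x)\<close>, where
  \<open>N w\<close> is \<open>c \<sigma>(w)\<close> or \<open>\<sigma>(w) c\<close>. Since \<open>\<sigma> \<noteq> id\<close>, the map \<open>N\<close> is not \<open>B\<close>-bilinear, and therefore the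
  middle nucleus is exactly \<open>B \<oplus> 0\<close>. An automorphism \<open>G\<close> preserves it, hence induces
  \<open>\<tau> \<in> Aut(B)\<close>. As \<open>(0, 1)\<close> commutes with \<open>B \<oplus> 0\<close>, its image \<open>(a, b)\<close> has central entries;
  as its square lies in \<open>B \<oplus> 0\<close>, \<open>2 a b = 0\<close>, so \<open>a = 0\<close>. Applying \<open>G\<close> to
  \<open>(0, u) (0, 1) = (N u, 0)\<close> gives \<open>\<tau> (N u) = b\<^sup>2 N (\<tau> u)\<close>, which at \<open>u = 1\<close> is the condition on \<open>c\<close>
  and then yields \<open>\<tau> \<sigma> = \<sigma> \<tau>\<close>.
\<close>

definition double_mult :: "('b::ring_1 \<Rightarrow> 'b) \<Rightarrow> 'b \<times> 'b \<Rightarrow> 'b \<times> 'b \<Rightarrow> 'b \<times> 'b"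
  where "double_mult N = (\<lambda>(u, v) (x, y). (u * x + N (v * y), u * y + v * x))"

lemma double_mult_simp [simp]:
  "double_mult N (u, v) (x, y) = (u * x + N (v * y), u * y + v * x)"
  by (simp add: double_mult_def)

definition middle_nucleus :: "('a \<Rightarrow> 'a \<Rightarrow> 'a) \<Rightarrow> 'a set"
  where "middle_nucleus mult = {m. \<forall>x y. mult (mult x m) y = mult x (mult m y)}"

text \<open>Both directions are used later: from right to left, \<open>G\<close> maps B \<oplus> 0
  into itself; from left to right, \<tau> is surjective and the second component of
  \<open>G (0, 1)\<close> is nonzero.\<close>

lemma middle_nucleus_image_iff:
  assumes "bij f" and "\<And>x y. f (mult x y) = mult (f x) (f y)"
  shows "f m \<in> middle_nucleus mult \<longleftrightarrow> m \<in> middle_nucleus mult"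
proof
  assume m: "f m \<in> middle_nucleus mult"
  have "f (mult (mult x m) y) = f (mult x (mult m y))" for x y
    using m by (simp add: assms(2) middle_nucleus_def)
  then show "m \<in> middle_nucleus mult"
    using assms(1) by (simp add: middle_nucleus_def bij_def inj_eq)
next
  assume m: "m \<in> middle_nucleus mult"
  have "mult (mult x (f m)) y = mult x (mult (f m) y)" for x y
  proof -
    obtain x' y' where "x = f x'" "y = f y'"
      using assms(1) by (metis bij_pointE)
    then show ?thesis
      using m by (simp flip: assms(2) add: middle_nucleus_def)
  qed
  then show "f m \<in> middle_nucleus mult"
    by (simp add: middle_nucleus_def)
qed

lemma middle_nucleus_double_mult:
  fixes N :: "'b::division_ring \<Rightarrow> 'b"
  assumes N_add: "\<And>x y. N (x + y) = N x + N y"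
    and not_bilinear: "\<not> (\<forall>x y. N (x * y) = N x * y \<and> N (x * y) = x * N y)"
  shows "middle_nucleus (double_mult N) = {m. snd m = 0}"
proof (intro equalityI subsetI)
  fix m assume m: "m \<in> middle_nucleus (double_mult N)"
  obtain a b where ab: "m = (a, b)" by fastforce
  have N0: "N 0 = 0"
    using N_add[of 0 0] by simp
  have assoc: "double_mult N (double_mult N x m) y = double_mult N x (double_mult N m y)" for x y
    using m unfolding middle_nucleus_def by blast
  have "b = 0"
  proof (rule ccontr)
    assume b: "b \<noteq> 0"
    have cancel: "inverse b * (b * y) = y" "b * (inverse b * y) = y" for y
      using b by (simp_all flip: mult.assoc)
    \<comment> \<open>Both test pairs carry a factor \<open>inverse b\<close> that meets the
      \<open>b\<close> of \<open>m\<close> inside \<open>N\<close>. The first components of the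
      associativity law then give linearity of \<open>N\<close> on one side each.\<close>
    have right: "N (x * y) = N x * y" for x y
      using assoc[of "(0, x * inverse b)" "(y, 0)"] b by (simp add: ab N0 mult.assoc cancel)
    have left: "N (x * y) = x * N y" for x y
      using assoc[of "(x, 0)" "(0, inverse b * y)"] b
      by (simp add: ab N0 N_add mult.assoc cancel)
    show False
      using not_bilinear left right by blast
  qed
  then show "m \<in> {m. snd m = 0}"
    by (simp add: ab)
next
  fix m :: "'b \<times> 'b" assume "m \<in> {m. snd m = 0}"
  then obtain a where "m = (a, 0)"
    by (metis (mono_tags) mem_Collect_eq prod.collapse)
  \<comment> \<open>For \<open>m = (a, 0)\<close> both bracketings contain the same term
    \<open>N (v * a * y)\<close>, so associativity of B is enough.\<close>
  moreover have "N 0 = 0"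
    using N_add[of 0 0] by simp
  ultimately show "m \<in> middle_nucleus (double_mult N)"
    by (auto simp: middle_nucleus_def algebra_simps)
qed

lemma CHAR_ne_2_imp_two_ne_0:
  assumes "CHAR('f::field) \<noteq> 2"
  shows "(2 :: 'f) \<noteq> 0"
proof
  assume "(2 :: 'f) = 0"
  then have "CHAR('f) dvd 2"
    using of_nat_eq_0_iff_char_dvd[of 2, where ?'a = 'f] by simp
  moreover have "n = 1" if "n dvd 2" "n \<noteq> 2" for n :: nat
    using that dvd_imp_le[of n 2] by (cases "n = 0") auto
  ultimately have "CHAR('f) = 1"
    using assms by blast
  then show False
    using of_nat_CHAR[where ?'a = 'f] by simp
qed

text \<open>The carrier is narrowed from \<open>ring_1\<close> to \<open>division_ring\<close>, so
  that \<open>middle_nucleus_double_mult\<close> applies.\<close>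

locale central_division_algebra = central_simple_algebra smul
  for smul :: "'f::field \<Rightarrow> 'b::division_ring \<Rightarrow> 'b"
begin

sublocale prod: module_prod smul smul
  by unfold_locales

lemma prod_scale: "prod.scale a (x, y) = (smul a x, smul a y)"
  by (simp add: prod.scale_def)

text \<open>The predicate \<open>Vector_Spaces.linear\<close> contains the vector space axioms; this
  supplies them for B \<oplus> B in \<open>prod_alg_automorphism_iff\<close>.\<close>

lemma vector_space_prod: "vector_space prod.scale"
  by unfold_locales (auto simp: prod.scale_def algebra_simps)

lemma alg_automorphism_iff:
  "alg_automorphism smul (*) f \<longleftrightarrow> bij f \<and> (\<forall>x y. f (x + y) = f x + f y) \<and>
    (\<forall>a x. f (smul a x) = smul a (f x)) \<and> (\<forall>x y. f (x * y) = f x * f y)"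
  using vector_space_axioms by (auto simp: alg_automorphism_def Vector_Spaces.linear_iff)

lemma prod_alg_automorphism_iff:
  "alg_automorphism prod.scale mult f \<longleftrightarrow> bij f \<and> (\<forall>x y. f (x + y) = f x + f y) \<and>
    (\<forall>a x. f (prod.scale a x) = prod.scale a (f x)) \<and> (\<forall>x y. f (mult x y) = mult (f x) (f y))"
  using vector_space_prod by (auto simp: alg_automorphism_def Vector_Spaces.linear_iff)

text \<open>If \<open>f x = 1\<close>, then \<open>f 1 = f 1 * f x = f (1 * x) = 1\<close>.\<close>

lemma alg_automorphism_one:
  assumes "alg_automorphism smul (*) f"
  shows "f 1 = 1"
proof -
  obtain x where "f x = 1"
    using assms unfolding alg_automorphism_iff by (metis bij_pointE)
  then show ?thesis
    using assms unfolding alg_automorphism_iff by (metis mult_1_right mult_1_left)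
qed

text \<open>The conditions on \<tau> and \<open>b\<close> appear as one identity between \<tau> and
  \<open>N\<close>, free of \<sigma> and \<open>c\<close>, so that both algebras are treated at
  once.\<close>

lemma double_automorphism_form:
  assumes two: "(2 :: 'f) \<noteq> 0"
    and N_add: "\<And>x y. N (x + y) = N x + N y"
    and N_smul: "\<And>a x. N (smul a x) = smul a (N x)"
    and not_bilinear: "\<not> (\<forall>x y. N (x * y) = N x * y \<and> N (x * y) = x * N y)"
    and G: "alg_automorphism prod.scale (double_mult N) G"
  shows "\<exists>\<tau> b. alg_automorphism smul (*) \<tau> \<and> b \<noteq> 0 \<and> (\<forall>u. \<tau> (N u) = smul (b\<^sup>2) (N (\<tau> u))) \<and>
    (\<forall>u v. G (u, v) = (\<tau> u, smul b (\<tau> v)))"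
proof -
  have N0: "N 0 = 0"
    using N_add[of 0 0] by simp
  have bij: "bij G" and add: "G (x + y) = G x + G y"
    and scale: "G (prod.scale r x) = prod.scale r (G x)"
    and mult: "G (double_mult N x y) = double_mult N (G x) (G y)" for x y r
    using G unfolding prod_alg_automorphism_iff by blast+
  have snd_G: "snd (G m) = 0 \<longleftrightarrow> snd m = 0" for m
    using middle_nucleus_image_iff[of G "double_mult N" m, OF bij mult]
      middle_nucleus_double_mult[OF N_add not_bilinear] by simp
  define \<tau> where "\<tau> u = fst (G (u, 0))" for u
  have G_left: "G (u, 0) = (\<tau> u, 0)" for u
    using snd_G[of "(u, 0)"] by (simp add: \<tau>_def prod_eq_iff)
  have \<tau>_add: "\<tau> (x + y) = \<tau> x + \<tau> y" for x y
    using add[of "(x, 0)" "(y, 0)"] by (simp add: G_left)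
  have \<tau>_smul: "\<tau> (smul r x) = smul r (\<tau> x)" for r x
    using scale[of r "(x, 0)"] by (simp add: G_left prod_scale)
  have \<tau>_mult: "\<tau> (x * y) = \<tau> x * \<tau> y" for x y
    using mult[of "(x, 0)" "(y, 0)"] by (simp add: G_left N0)
  have "inj \<tau>"
  proof (rule injI)
    fix x y assume "\<tau> x = \<tau> y"
    then have "G (x, 0) = G (y, 0)"
      by (simp add: G_left)
    then show "x = y"
      using bij by (simp add: bij_def inj_eq)
  qed
  \<comment> \<open>The \<open>G\<close>-preimage of \<open>(w, 0)\<close> lies in the middle
    nucleus, hence in B \<oplus> 0.\<close>
  moreover have surj: "\<exists>u. \<tau> u = w" for w
  proof -
    obtain m where m: "G m = (w, 0)"
      using bij by (metis bij_pointE)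
    then have "snd m = 0"
      using snd_G[of m] by simp
    then show ?thesis
      using m by (metis \<tau>_def fst_conv prod.collapse)
  qed
  ultimately have \<tau>: "alg_automorphism smul (*) \<tau>"
    by (auto simp: alg_automorphism_iff \<tau>_add \<tau>_smul \<tau>_mult bij_def surj_def) (metis surj)
  obtain a b where ab: "G (0, 1) = (a, b)"
    by fastforce
  \<comment> \<open>The pair \<open>(0, v)\<close> factors both as \<open>(v, 0) (0, 1)\<close> and
    as \<open>(0, 1) (v, 0)\<close>. Comparing the two images makes \<open>a\<close> and
    \<open>b\<close> commute with the range of \<tau>, which is all of B.\<close>
  have left: "G (0, v) = (\<tau> v * a, \<tau> v * b)" for v
    using mult[of "(v, 0)" "(0, 1)"] by (simp add: ab G_left N0)
  have right: "G (0, v) = (a * \<tau> v, b * \<tau> v)" for v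
    using mult[of "(0, 1)" "(v, 0)"] by (simp add: ab G_left N0)
  have "a * w = w * a" "b * w = w * b" for w
    using left right surj[of w] by auto
  then obtain \<alpha> \<beta> where \<alpha>: "a = smul \<alpha> 1" and \<beta>: "b = smul \<beta> 1"
    using central by blast
  have "b \<noteq> 0"
    using snd_G[of "(0, 1)"] by (simp add: ab)
  then have \<beta>0: "\<beta> \<noteq> 0"
    by (auto simp: \<beta>)
  \<comment> \<open>The second component of the square of \<open>G (0, 1)\<close> is
    \<open>a * b + b * a\<close>. Written with scalars it becomes 2 \<alpha> \<beta>, to which the
    assumption on 2 in F applies.\<close>
  have ab_eq: "a * b = smul (\<alpha> * \<beta>) 1" "b * a = smul (\<alpha> * \<beta>) 1"
    by (simp_all add: \<alpha> \<beta> smul_mult_left mult.commute)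
  have "smul (2 * (\<alpha> * \<beta>)) 1 = a * b + b * a"
    by (simp only: ab_eq mult_2 scale_left_distrib)
  also have "\<dots> = 0"
    using mult[of "(0, 1)" "(0, 1)"] by (simp add: ab G_left)
  finally have \<alpha>0: "\<alpha> = 0"
    using two \<beta>0 by simp
  have G_right: "G (0, v) = (0, smul \<beta> (\<tau> v))" for v
    using left[of v] by (simp add: \<alpha> \<beta> \<alpha>0 smul_mult_right)
  have "G (u, v) = (\<tau> u, smul \<beta> (\<tau> v))" for u v
    using add[of "(u, 0)" "(0, v)"] by (simp add: G_left G_right)
  moreover have "\<tau> (N u) = smul (\<beta>\<^sup>2) (N (\<tau> u))" for u
    using mult[of "(0, u)" "(0, 1)"] alg_automorphism_one[OF \<tau>]
    by (simp add: G_left G_right N_smul smul_mult_left smul_mult_right power2_eq_square)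
  ultimately show ?thesis
    using \<tau> \<beta>0 by blast
qed

text \<open>In the first component of a product, the two factors \<open>b\<close> leave
  \<open>N\<close> as \<open>b\<^sup>2\<close>, which is what \<open>comm\<close> matches; in the
  second, each summand carries exactly one \<open>b\<close>.\<close>

lemma double_automorphismI:
  assumes N_smul: "\<And>a x. N (smul a x) = smul a (N x)"
    and \<tau>: "alg_automorphism smul (*) \<tau>" and b: "b \<noteq> 0"
    and comm: "\<And>u. \<tau> (N u) = smul (b\<^sup>2) (N (\<tau> u))"
  shows "alg_automorphism prod.scale (double_mult N) (\<lambda>(u, v). (\<tau> u, smul b (\<tau> v)))"
proof -
  have bij: "bij \<tau>" and hom: "\<tau> (x + y) = \<tau> x + \<tau> y" "\<tau> (smul a x) = smul a (\<tau> x)"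
    "\<tau> (x * y) = \<tau> x * \<tau> y" for x y a
    using \<tau> by (auto simp: alg_automorphism_iff)
  let ?G = "\<lambda>(u, v). (\<tau> u, smul b (\<tau> v))"
  have "bij ?G"
  proof (rule o_bij)
    let ?H = "\<lambda>(u, v). (inv \<tau> u, inv \<tau> (smul (inverse b) v))"
    show "?H \<circ> ?G = id" "?G \<circ> ?H = id"
      using bij b by (auto simp: fun_eq_iff bij_is_inj bij_is_surj surj_f_inv_f)
  qed
  then show ?thesis
    by (auto simp: prod_alg_automorphism_iff prod_scale hom comm N_smul scale_right_distrib
        smul_mult_left smul_mult_right power2_eq_square mult.commute)
qed

end

theorem theorem3p18:
  fixes smul :: "'f::field \<Rightarrow> 'b::division_ring \<Rightarrow> 'b"
    and \<sigma> :: "'b \<Rightarrow> 'b" and c :: 'b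
    and mult :: "'b \<times> 'b \<Rightarrow> 'b \<times> 'b \<Rightarrow> 'b \<times> 'b"
  assumes "CHAR('f) \<noteq> 2"
    and "central_simple_algebra smul"
    and "alg_automorphism smul (*) \<sigma>" and "\<sigma> \<noteq> id"
    and "c \<noteq> 0"
    and "mult = D_mult \<sigma> c \<or> mult = Dr_mult \<sigma> c"
  shows "(\<forall>G. alg_automorphism (module_prod.scale smul smul) mult G \<longrightarrow>
      (\<exists>\<tau> b. alg_automorphism smul (*) \<tau> \<and> \<tau> \<circ> \<sigma> = \<sigma> \<circ> \<tau> \<and>
        b \<noteq> 0 \<and> \<tau> c = smul (b\<^sup>2) c \<and> (\<forall>u v. G (u, v) = (\<tau> u, smul b (\<tau> v))))) \<and>
    (\<forall>\<tau> b. alg_automorphism smul (*) \<tau> \<and> \<tau> \<circ> \<sigma> = \<sigma> \<circ> \<tau> \<and>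
        b \<noteq> 0 \<and> \<tau> c = smul (b\<^sup>2) c \<longrightarrow>
      alg_automorphism (module_prod.scale smul smul) mult (\<lambda>(u, v). (\<tau> u, smul b (\<tau> v))))"
proof -
  interpret central_division_algebra smul
    using assms(2) by (simp add: central_division_algebra_def)
  have \<sigma>: "\<sigma> (x + y) = \<sigma> x + \<sigma> y" "\<sigma> (smul a x) = smul a (\<sigma> x)" for x y a
    using assms(3) by (auto simp: alg_automorphism_iff)
  have \<sigma>1: "\<sigma> 1 = 1"
    using assms(3) by (rule alg_automorphism_one)
  have "D_mult \<sigma> c = double_mult (\<lambda>w. c * \<sigma> w)" "Dr_mult \<sigma> c = double_mult (\<lambda>w. \<sigma> w * c)"
    by (simp_all add: D_mult_def Dr_mult_def double_mult_def)
  then obtain N where N: "mult = double_mult N" "N = (\<lambda>w. c * \<sigma> w) \<or> N = (\<lambda>w. \<sigma> w * c)"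
    using assms(6) by blast
  have N_add: "N (x + y) = N x + N y" and N_smul: "N (smul a x) = smul a (N x)" for x y a
    using N(2) by (auto simp: \<sigma> distrib_left distrib_right smul_mult_left smul_mult_right)
  have not_bilinear: "\<not> (\<forall>x y. N (x * y) = N x * y \<and> N (x * y) = x * N y)"
  proof
    assume bilinear: "\<forall>x y. N (x * y) = N x * y \<and> N (x * y) = x * N y"
    \<comment> \<open>Here \<open>N 1 = c\<close>. With \<open>c\<close> on the left,
      \<open>N w = N 1 * w\<close> gives the claim after cancelling \<open>c\<close>; with
      \<open>c\<close> on the right, \<open>N w = w * N 1\<close> does.\<close>
    have "\<sigma> w = w" for w
      using N(2) bilinear[rule_format, of 1 w] bilinear[rule_format, of w 1] assms(5)
      by (auto simp: \<sigma>1) (metis mult_left_cancel)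
    then show False
      using assms(4) by (simp add: fun_eq_iff)
  qed
  \<comment> \<open>Since \<sigma> fixes 1, the case \<open>u = 1\<close> is the condition on
    \<open>c\<close>. Inserting it for general \<open>u\<close> leaves the common factors
    \<open>b\<^sup>2\<close> and \<open>c\<close>, both nonzero, and cancelling them gives
    commutation with \<sigma>.\<close>
  have comm_iff: "(\<forall>u. \<tau> (N u) = smul (b\<^sup>2) (N (\<tau> u))) \<longleftrightarrow>
      \<tau> \<circ> \<sigma> = \<sigma> \<circ> \<tau> \<and> \<tau> c = smul (b\<^sup>2) c" (is "?L \<longleftrightarrow> ?R")
    if \<tau>: "alg_automorphism smul (*) \<tau>" and b: "b \<noteq> 0" for \<tau> b
  proof -
    have \<tau>_mult: "\<tau> (x * y) = \<tau> x * \<tau> y" for x y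
      using \<tau> by (simp add: alg_automorphism_iff)
    show ?thesis
    proof
      assume L: ?L
      have \<tau>c: "\<tau> c = smul (b\<^sup>2) c"
        using L[rule_format, of 1] N(2) by (auto simp: \<sigma>1 alg_automorphism_one[OF \<tau>])
      have "\<tau> (\<sigma> u) = \<sigma> (\<tau> u)" for u
        using L[rule_format, of u] N(2) b assms(5)
        by (auto simp: \<tau>_mult \<tau>c smul_mult_left smul_mult_right)
      with \<tau>c show ?R
        by (simp add: fun_eq_iff)
    next
      assume ?R
      then show ?L
        using N(2) by (auto simp: \<tau>_mult smul_mult_left smul_mult_right fun_eq_iff)
    qed
  qed
  have "\<exists>\<tau> b. alg_automorphism smul (*) \<tau> \<and> \<tau> \<circ> \<sigma> = \<sigma> \<circ> \<tau> \<and>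
      b \<noteq> 0 \<and> \<tau> c = smul (b\<^sup>2) c \<and> (\<forall>u v. G (u, v) = (\<tau> u, smul b (\<tau> v)))"
    if "alg_automorphism prod.scale mult G" for G
    using double_automorphism_form[OF CHAR_ne_2_imp_two_ne_0[OF assms(1)] N_add N_smul
        not_bilinear that[unfolded N(1)]] comm_iff by blast
  moreover have "alg_automorphism prod.scale mult (\<lambda>(u, v). (\<tau> u, smul b (\<tau> v)))"
    if "alg_automorphism smul (*) \<tau>" "\<tau> \<circ> \<sigma> = \<sigma> \<circ> \<tau>" "b \<noteq> 0" "\<tau> c = smul (b\<^sup>2) c" for \<tau> b
  proof -
    have "\<tau> (N u) = smul (b\<^sup>2) (N (\<tau> u))" for u
      using comm_iff[OF that(1,3)] that(2,4) by blast
    then show ?thesis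
      unfolding N(1) by (rule double_automorphismI[OF N_smul that(1,3)])
  qed
  ultimately show ?thesis
    by blast
qed

end
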